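(* Fix an integration structure $((\Omega,\mathcal H),\mathfrak N,((X,\eta_1),(Y,\eta_2),(Z,\eta_3);\bullet))$ and a set function $\mu:\mathcal H\to Y$. If $f_1,f_2:\Omega\to X$ are net Riemann integrable with respect to $\mu$ on each $A\in\mathcal H$, then for all real constants $a,b\in\mathbb R$ the function $af_1+bf_2$ is net Riemann integrable on each $A\in\mathcal H$ and $$\int_A(af_1+bf_2)\,d\mu=a\int_A f_1\,d\mu+b\int_A f_2\,d\mu\qquad\text{for each }A\in\mathcal H.$$
   Context: A net convergence structure $\eta$ on a set $V$ assigns to each $v\in V$ a class $\eta(v)$ of nets in $V$ (those "converging to $v$") such that: (i) constant nets equal to $v$ converge to $v$; (ii) every quasi-subnet of a net converging to $v$ converges to $v$, where $(y_j)_{j\in J}$ is a quasi-subnet of $(x_i)_{i\in I}$ if for every $i_0\in I$ there is $j_0\in J$ with $\{y_j:j\ge j_0\}\subseteq\{x_i:i\ge i_0\}$; (iii) if $(x_i)_{i\in I}$ and $(y_i)_{i\in I}$ converge to $v$ and $z_i\in\{x_i,y_i\}$ for all $i$, then $(z_i)$ converges to $v$. A map is continuous if it sends nets converging to $v$ to nets converging to the image of $v$; products carry coordinatewise convergence. Standing assumptions: vector spaces are real; all net convergence structures are Hausdorff (limits are unique); on a vector space, addition and multiplication by each fixed real number are continuous. A bilinear product is a bilinear map $\bullet:X\times Y\to Z$ (written by juxtaposition) such that $x\mapsto x\bullet y$ and $y\mapsto x\bullet y$ are continuous. A paved space $(\Omega,\mathcal H)$ is a nonempty set $\Omega$ with a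 collection $\mathcal H$ of subsets with $\emptyset\in\mathcal H$. For each $A\in\mathcal H$ a Fleischer–Szabó–Száz net $\{(\sigma_\gamma,\tau_\gamma)\}_{\gamma\in\Gamma_A}$ is given: $\Gamma_A$ is a directed set and $\sigma_\gamma=\{\sigma_{\gamma_i}\}_{i\in I_\gamma}$, $\tau_\gamma=\{\tau_{\gamma_i}\}_{i\in I_\gamma}$ are finite families in $\mathcal H$ and $\Omega$ respectively. An integration structure consists of $(\Omega,\mathcal H)$, these nets $\mathfrak N$, and vector spaces with net convergence structures connected by a bilinear product. For $f:\Omega\to X$, $\mu:\mathcal H\to Y$ put $S^A_\gamma(f,\mu)=\sum_{i\in I_\gamma}f(\tau_{\gamma_i})\mu(\sigma_{\gamma_i})$. $f$ is net Riemann integrable on $A$ if $\int_A f\,d\mu:=\lim_{\gamma\in\Gamma_A}S^A_\gamma(f,\mu)$ exists in $(Z,\eta_3)$. *)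

theory Defs
  imports "HOL-Analysis.Analysis"
begin

text \<open>
  A net is given by an index set, a relation directing it, and a map of which only the values on
  the index set matter. The nets in a space form a proper class; here they are the nets whose
  index set is a subset of an arbitrary type \<open>'i\<close>. The axioms below
  only ever concern these nets, so a convergence structure on all nets restricts to one over any
  \<open>'i\<close>, and any given set of directed index sets fits into a suitable \<open>'i\<close>.
\<close>

type_synonym ('i, 'v) net = "'i set \<times> 'i rel \<times> ('i \<Rightarrow> 'v)"

definition directed_set :: "'i set \<Rightarrow> 'i rel \<Rightarrow> bool" where
  "directed_set I r \<longleftrightarrow> I \<noteq> {} \<and> preorder_on I r \<and>
     (\<forall>i\<in>I. \<forall>j\<in>I. \<exists>k\<in>I. (i, k) \<in> r \<and> (j, k) \<in> r)"

definition is_net :: "('i, 'v) net \<Rightarrow> bool" where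
  "is_net = (\<lambda>(I, r, x). directed_set I r)"

definition tail :: "('i, 'v) net \<Rightarrow> 'i \<Rightarrow> 'v set" where
  "tail = (\<lambda>(I, r, x) i\<^sub>0. {x i |i. i \<in> I \<and> (i\<^sub>0, i) \<in> r})"

definition quasi_subnet :: "('i, 'v) net \<Rightarrow> ('i, 'v) net \<Rightarrow> bool" where
  "quasi_subnet M N \<longleftrightarrow> is_net M \<and> is_net N \<and>
     (\<forall>i\<^sub>0\<in>fst N. \<exists>j\<^sub>0\<in>fst M. tail M j\<^sub>0 \<subseteq> tail N i\<^sub>0)"

definition map_net :: "('v \<Rightarrow> 'w) \<Rightarrow> ('i, 'v) net \<Rightarrow> ('i, 'w) net" where
  "map_net f = (\<lambda>(I, r, x). (I, r, \<lambda>i. f (x i)))"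

locale net_convergence_structure =
  fixes \<eta> :: "'v \<Rightarrow> ('i, 'v) net set"
  assumes nets: "N \<in> \<eta> v \<Longrightarrow> is_net N"
    and constant_nets: "directed_set I r \<Longrightarrow> (I, r, \<lambda>_. v) \<in> \<eta> v"
    and quasi_subnets: "N \<in> \<eta> v \<Longrightarrow> quasi_subnet M N \<Longrightarrow> M \<in> \<eta> v"
    and mixing: "(I, r, x) \<in> \<eta> v \<Longrightarrow> (I, r, y) \<in> \<eta> v \<Longrightarrow>
      (\<And>i. i \<in> I \<Longrightarrow> z i \<in> {x i, y i}) \<Longrightarrow> (I, r, z) \<in> \<eta> v"

locale Hausdorff_net_convergence_structure = net_convergence_structure +
  assumes Hausdorff: "N \<in> \<eta> v \<Longrightarrow> N \<in> \<eta> w \<Longrightarrow> v = w"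

definition net_continuous ::
  "('v \<Rightarrow> ('i, 'v) net set) \<Rightarrow> ('w \<Rightarrow> ('i, 'w) net set) \<Rightarrow> ('v \<Rightarrow> 'w) \<Rightarrow> bool" where
  "net_continuous \<eta> \<xi> f \<longleftrightarrow> (\<forall>v. \<forall>N\<in>\<eta> v. map_net f N \<in> \<xi> (f v))"

definition prod_convergence ::
  "('v \<Rightarrow> ('i, 'v) net set) \<Rightarrow> ('w \<Rightarrow> ('i, 'w) net set) \<Rightarrow> 'v \<times> 'w \<Rightarrow> ('i, 'v \<times> 'w) net set" where
  "prod_convergence \<eta> \<xi> = (\<lambda>(v, w). {N. map_net fst N \<in> \<eta> v \<and> map_net snd N \<in> \<xi> w})"

locale net_convergence_vector_space = Hausdorff_net_convergence_structure \<eta>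
  for \<eta> :: "'v::real_vector \<Rightarrow> ('i, 'v) net set" +
  assumes add_continuous: "net_continuous (prod_convergence \<eta> \<eta>) \<eta> (\<lambda>(u, v). u + v)"
    and scale_continuous: "net_continuous \<eta> \<eta> (\<lambda>v. c *\<^sub>R v)"

definition bilinear_product ::
  "('x::real_vector \<Rightarrow> ('i, 'x) net set) \<Rightarrow> ('y::real_vector \<Rightarrow> ('i, 'y) net set) \<Rightarrow>
   ('z::real_vector \<Rightarrow> ('i, 'z) net set) \<Rightarrow> ('x \<Rightarrow> 'y \<Rightarrow> 'z) \<Rightarrow> bool" where
  "bilinear_product \<eta>\<^sub>1 \<eta>\<^sub>2 \<eta>\<^sub>3 B \<longleftrightarrow>
     bilinear B \<and>
     (\<forall>y. net_continuous \<eta>\<^sub>1 \<eta>\<^sub>3 (\<lambda>x. B x y)) \<and> (\<forall>x. net_continuous \<eta>\<^sub>2 \<eta>\<^sub>3 (\<lambda>y. B x y))"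

locale paved_space =
  fixes \<Omega> :: "'o set" and H :: "'o set set"
  assumes nonempty: "\<Omega> \<noteq> {}"
    and subsets: "H \<subseteq> Pow \<Omega>"
    and empty_mem: "{} \<in> H"

text \<open>
  The data of a Fleischer--Szabo--Szaz net: the directed set \<open>(\<Gamma>, \<le>)\<close> and, for each \<open>\<gamma> \<in> \<Gamma>\<close>, the
  index set \<open>I\<^sub>\<gamma>\<close> (\<open>fam_index\<close>) with the families \<open>\<sigma>\<^sub>\<gamma>\<close> (\<open>fam_sets\<close>) and \<open>\<tau>\<^sub>\<gamma>\<close> (\<open>fam_points\<close>).
\<close>

record ('i, 'k, 'o) FSS_data =
  dir_index :: "'i set"
  dir_rel :: "'i rel"
  fam_index :: "'i \<Rightarrow> 'k set"
  fam_sets :: "'i \<Rightarrow> 'k \<Rightarrow> 'o set"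
  fam_points :: "'i \<Rightarrow> 'k \<Rightarrow> 'o"

locale FSS_net = paved_space \<Omega> H
  for \<Omega> :: "'o set" and H :: "'o set set" +
  fixes D :: "('i, 'k, 'o) FSS_data"
  assumes directed: "directed_set (dir_index D) (dir_rel D)"
    and finite_fam: "\<gamma> \<in> dir_index D \<Longrightarrow> finite (fam_index D \<gamma>)"
    and fam_sets_mem: "\<gamma> \<in> dir_index D \<Longrightarrow> i \<in> fam_index D \<gamma> \<Longrightarrow> fam_sets D \<gamma> i \<in> H"
    and fam_points_mem: "\<gamma> \<in> dir_index D \<Longrightarrow> i \<in> fam_index D \<gamma> \<Longrightarrow> fam_points D \<gamma> i \<in> \<Omega>"

locale integration_structure = paved_space \<Omega> H
  for \<Omega> :: "'o set" and H :: "'o set set" +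
  fixes \<NN> :: "'o set \<Rightarrow> ('i, 'k, 'o) FSS_data"
    and \<eta>\<^sub>1 :: "'x::real_vector \<Rightarrow> ('i, 'x) net set"
    and \<eta>\<^sub>2 :: "'y::real_vector \<Rightarrow> ('i, 'y) net set"
    and \<eta>\<^sub>3 :: "'z::real_vector \<Rightarrow> ('i, 'z) net set"
    and B :: "'x \<Rightarrow> 'y \<Rightarrow> 'z"
  assumes FSS_nets: "A \<in> H \<Longrightarrow> FSS_net \<Omega> H (\<NN> A)"
    and vector_spaces: "net_convergence_vector_space \<eta>\<^sub>1" "net_convergence_vector_space \<eta>\<^sub>2"
      "net_convergence_vector_space \<eta>\<^sub>3"
    and product: "bilinear_product \<eta>\<^sub>1 \<eta>\<^sub>2 \<eta>\<^sub>3 B"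

definition riemann_sum ::
  "('i, 'k, 'o) FSS_data \<Rightarrow> ('x \<Rightarrow> 'y \<Rightarrow> 'z::comm_monoid_add) \<Rightarrow> ('o \<Rightarrow> 'x) \<Rightarrow> ('o set \<Rightarrow> 'y) \<Rightarrow> 'i \<Rightarrow> 'z" where
  "riemann_sum D B f \<mu> \<gamma> = (\<Sum>i\<in>fam_index D \<gamma>. B (f (fam_points D \<gamma> i)) (\<mu> (fam_sets D \<gamma> i)))"

definition riemann_net ::
  "('i, 'k, 'o) FSS_data \<Rightarrow> ('x \<Rightarrow> 'y \<Rightarrow> 'z::comm_monoid_add) \<Rightarrow> ('o \<Rightarrow> 'x) \<Rightarrow> ('o set \<Rightarrow> 'y) \<Rightarrow> ('i, 'z) net" where
  "riemann_net D B f \<mu> = (dir_index D, dir_rel D, riemann_sum D B f \<mu>)"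

definition net_Riemann_integrable ::
  "('o set \<Rightarrow> ('i, 'k, 'o) FSS_data) \<Rightarrow> ('z::comm_monoid_add \<Rightarrow> ('i, 'z) net set) \<Rightarrow>
   ('x \<Rightarrow> 'y \<Rightarrow> 'z) \<Rightarrow> ('o set \<Rightarrow> 'y) \<Rightarrow> ('o \<Rightarrow> 'x) \<Rightarrow> 'o set \<Rightarrow> bool" where
  "net_Riemann_integrable \<NN> \<eta>\<^sub>3 B \<mu> f A \<longleftrightarrow> (\<exists>z. riemann_net (\<NN> A) B f \<mu> \<in> \<eta>\<^sub>3 z)"

definition net_Riemann_integral ::
  "('o set \<Rightarrow> ('i, 'k, 'o) FSS_data) \<Rightarrow> ('z::comm_monoid_add \<Rightarrow> ('i, 'z) net set) \<Rightarrow>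
   ('x \<Rightarrow> 'y \<Rightarrow> 'z) \<Rightarrow> ('o set \<Rightarrow> 'y) \<Rightarrow> ('o \<Rightarrow> 'x) \<Rightarrow> 'o set \<Rightarrow> 'z" where
  "net_Riemann_integral \<NN> \<eta>\<^sub>3 B \<mu> f A = (THE z. riemann_net (\<NN> A) B f \<mu> \<in> \<eta>\<^sub>3 z)"

end

theory Submission
  imports Defs
begin

text \<open>
  Every Riemann sum of \<open>a f\<^sub>1 + b f\<^sub>2\<close> is the same linear combination of the Riemann sums of \<open>f\<^sub>1\<close>
  and \<open>f\<^sub>2\<close> over the same tagged family, because the product is linear in its first factor
  (\<open>riemann_sum_linear\<close>). The sums of \<open>f\<^sub>1\<close> and \<open>f\<^sub>2\<close> on a set \<open>A\<close> run over one directed set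
  \<open>\<Gamma>\<^sub>A\<close>, so they pair to a single net in \<open>Z \<times> Z\<close>, and continuity of the vector space operations
  of \<open>Z\<close> passes to the limit (\<open>linear_combination_converges\<close>). Since limits in \<open>Z\<close> are unique,
  the limit found in this way is the integral.
\<close>

lemma (in net_convergence_vector_space) linear_combination_converges:
  assumes x: "(I, r, x) \<in> \<eta> v" and y: "(I, r, y) \<in> \<eta> w"
  shows "(I, r, \<lambda>i. a *\<^sub>R x i + b *\<^sub>R y i) \<in> \<eta> (a *\<^sub>R v + b *\<^sub>R w)"
proof -
  have scaled: "(I, r, \<lambda>i. c *\<^sub>R u i) \<in> \<eta> (c *\<^sub>R p)" if "(I, r, u) \<in> \<eta> p" for c u p
    using scale_continuous[of c] that unfolding net_continuous_def map_net_def by fastforce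
  let ?N = "(I, r, \<lambda>i. (a *\<^sub>R x i, b *\<^sub>R y i))"
  have "?N \<in> prod_convergence \<eta> \<eta> (a *\<^sub>R v, b *\<^sub>R w)"
    using scaled[OF x, of a] scaled[OF y, of b] by (simp add: prod_convergence_def map_net_def)
  then have "map_net (\<lambda>(u, v). u + v) ?N \<in> \<eta> (a *\<^sub>R v + b *\<^sub>R w)"
    using add_continuous unfolding net_continuous_def by fastforce
  then show ?thesis
    by (simp add: map_net_def)
qed

lemma riemann_sum_linear:
  assumes "bilinear B"
  shows "riemann_sum D B (\<lambda>\<omega>. a *\<^sub>R f \<omega> + b *\<^sub>R g \<omega>) \<mu> \<gamma> =
    a *\<^sub>R riemann_sum D B f \<mu> \<gamma> + b *\<^sub>R riemann_sum D B g \<mu> \<gamma>"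
  using assms
  by (simp add: riemann_sum_def bilinear_ladd bilinear_lmul sum.distrib scaleR_sum_right)

lemma net_Riemann_integral_eqI:
  fixes \<eta> :: "'z::comm_monoid_add \<Rightarrow> ('i, 'z) net set"
  assumes "Hausdorff_net_convergence_structure \<eta>"
    and "riemann_net (\<NN> A) B f \<mu> \<in> \<eta> z"
  shows "net_Riemann_integral \<NN> \<eta> B \<mu> f A = z"
  unfolding net_Riemann_integral_def using assms
  by (blast intro: the_equality Hausdorff_net_convergence_structure.Hausdorff)

theorem corollary2p2p1:
  fixes \<Omega> :: "'o set" and H :: "'o set set"
    and \<NN> :: "'o set \<Rightarrow> ('i, 'k, 'o) FSS_data"
    and \<eta>\<^sub>1 :: "'x::real_vector \<Rightarrow> ('i, 'x) net set"
    and \<eta>\<^sub>2 :: "'y::real_vector \<Rightarrow> ('i, 'y) net set"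
    and \<eta>\<^sub>3 :: "'z::real_vector \<Rightarrow> ('i, 'z) net set"
    and B :: "'x \<Rightarrow> 'y \<Rightarrow> 'z"
    and \<mu> :: "'o set \<Rightarrow> 'y"
    and f\<^sub>1 f\<^sub>2 :: "'o \<Rightarrow> 'x"
    and a b :: real
  assumes "integration_structure \<Omega> H \<NN> \<eta>\<^sub>1 \<eta>\<^sub>2 \<eta>\<^sub>3 B"
    and "\<forall>A\<in>H. net_Riemann_integrable \<NN> \<eta>\<^sub>3 B \<mu> f\<^sub>1 A"
    and "\<forall>A\<in>H. net_Riemann_integrable \<NN> \<eta>\<^sub>3 B \<mu> f\<^sub>2 A"
  shows "\<forall>A\<in>H.
    net_Riemann_integrable \<NN> \<eta>\<^sub>3 B \<mu> (\<lambda>\<omega>. a *\<^sub>R f\<^sub>1 \<omega> + b *\<^sub>R f\<^sub>2 \<omega>) A \<and>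
    net_Riemann_integral \<NN> \<eta>\<^sub>3 B \<mu> (\<lambda>\<omega>. a *\<^sub>R f\<^sub>1 \<omega> + b *\<^sub>R f\<^sub>2 \<omega>) A =
      a *\<^sub>R net_Riemann_integral \<NN> \<eta>\<^sub>3 B \<mu> f\<^sub>1 A + b *\<^sub>R net_Riemann_integral \<NN> \<eta>\<^sub>3 B \<mu> f\<^sub>2 A"
proof
  fix A assume "A \<in> H"
  interpret integration_structure \<Omega> H \<NN> \<eta>\<^sub>1 \<eta>\<^sub>2 \<eta>\<^sub>3 B by fact
  interpret Z: net_convergence_vector_space \<eta>\<^sub>3 by (fact vector_spaces)
  obtain z\<^sub>1 z\<^sub>2 where z\<^sub>1: "riemann_net (\<NN> A) B f\<^sub>1 \<mu> \<in> \<eta>\<^sub>3 z\<^sub>1"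
    and z\<^sub>2: "riemann_net (\<NN> A) B f\<^sub>2 \<mu> \<in> \<eta>\<^sub>3 z\<^sub>2"
    using assms(2,3) \<open>A \<in> H\<close> unfolding net_Riemann_integrable_def by blast
  have "bilinear B"
    using product unfolding bilinear_product_def by blast
  then have "riemann_sum (\<NN> A) B (\<lambda>\<omega>. a *\<^sub>R f\<^sub>1 \<omega> + b *\<^sub>R f\<^sub>2 \<omega>) \<mu> =
      (\<lambda>\<gamma>. a *\<^sub>R riemann_sum (\<NN> A) B f\<^sub>1 \<mu> \<gamma> + b *\<^sub>R riemann_sum (\<NN> A) B f\<^sub>2 \<mu> \<gamma>)"
    by (intro ext riemann_sum_linear)
  then have lim: "riemann_net (\<NN> A) B (\<lambda>\<omega>. a *\<^sub>R f\<^sub>1 \<omega> + b *\<^sub>R f\<^sub>2 \<omega>) \<mu> \<in> \<eta>\<^sub>3 (a *\<^sub>R z\<^sub>1 + b *\<^sub>R z\<^sub>2)"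
    using Z.linear_combination_converges z\<^sub>1 z\<^sub>2 by (simp add: riemann_net_def)
  note integral_eqI =
    net_Riemann_integral_eqI[OF Z.Hausdorff_net_convergence_structure_axioms, of \<NN> A B]
  show "net_Riemann_integrable \<NN> \<eta>\<^sub>3 B \<mu> (\<lambda>\<omega>. a *\<^sub>R f\<^sub>1 \<omega> + b *\<^sub>R f\<^sub>2 \<omega>) A \<and>
    net_Riemann_integral \<NN> \<eta>\<^sub>3 B \<mu> (\<lambda>\<omega>. a *\<^sub>R f\<^sub>1 \<omega> + b *\<^sub>R f\<^sub>2 \<omega>) A =
      a *\<^sub>R net_Riemann_integral \<NN> \<eta>\<^sub>3 B \<mu> f\<^sub>1 A + b *\<^sub>R net_Riemann_integral \<NN> \<eta>\<^sub>3 B \<mu> f\<^sub>2 A"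
    unfolding integral_eqI[OF z\<^sub>1] integral_eqI[OF z\<^sub>2] integral_eqI[OF lim]
    using lim unfolding net_Riemann_integrable_def by blast
qed

end
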